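(* Let $G$ be a connected undirected graph on $n\ge 2$ vertices with no loops but possibly multiple edges, let $|E(G)|$ be its number of edges, and let $\mathbf r$ be an arithmetical structure on $G$, with vertices ordered so that $r_1\ge r_2\ge\cdots\ge r_n$. Then \[r_1 \leq \frac{1}{(n-1)!}\, |E(G)|^{3\cdot 2^{n-2}-2}.\]
   Context: With vertices $v_1,\dots,v_n$ and $\delta_{ij}$ edges between $v_i$ and $v_j$, an arithmetical structure on $G$ is a pair $(\mathbf r,\mathbf d)$ of vectors of positive integers with $\gcd(r_1,\dots,r_n)=1$ and $r_id_i=\sum_{j\neq i}r_j\delta_{ij}$ for all $i$; it is identified with $\mathbf r$. *)

theory Defs
  imports Complex_Main
begin

record ('v, 'e) multigraph =
  verts :: "'v set"
  edges :: "'e set"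
  ends :: "'e \<Rightarrow> 'v set"

definition loopless_multigraph :: "('v, 'e) multigraph \<Rightarrow> bool" where
  "loopless_multigraph G \<longleftrightarrow>
     finite (verts G) \<and> finite (edges G) \<and>
     (\<forall>e\<in>edges G. ends G e \<subseteq> verts G \<and> card (ends G e) = 2)"

definition edge_mult :: "('v, 'e) multigraph \<Rightarrow> 'v \<Rightarrow> 'v \<Rightarrow> nat" where
  "edge_mult G x y = card {e \<in> edges G. ends G e = {x, y}}"

definition adjacency :: "('v, 'e) multigraph \<Rightarrow> ('v \<times> 'v) set" where
  "adjacency G = {(x, y). \<exists>e\<in>edges G. ends G e = {x, y}}"

definition connected_multigraph :: "('v, 'e) multigraph \<Rightarrow> bool" where
  "connected_multigraph G \<longleftrightarrow>
     verts G \<noteq> {} \<and> (\<forall>x\<in>verts G. \<forall>y\<in>verts G. (x, y) \<in> (adjacency G)\<^sup>*)"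

text \<open>The vectors \<open>r\<close> and \<open>d\<close> are indexed by the vertices themselves; values
  outside \<open>verts G\<close> are irrelevant.\<close>

definition arithmetical_structure ::
  "('v, 'e) multigraph \<Rightarrow> ('v \<Rightarrow> nat) \<Rightarrow> ('v \<Rightarrow> nat) \<Rightarrow> bool" where
  "arithmetical_structure G r d \<longleftrightarrow>
     (\<forall>x\<in>verts G. r x > 0 \<and> d x > 0) \<and>
     Gcd (r ` verts G) = 1 \<and>
     (\<forall>x\<in>verts G. r x * d x = (\<Sum>y\<in>verts G - {x}. r y * edge_mult G x y))"

end

theory Submission
  imports Defs
begin

text \<open>
  Eliminate a vertex \<open>x\<close> where \<open>r\<close> is largest: with \<open>d\<close> the second component of the structure at
  \<open>x\<close>, put \<open>d * w j k + w j x * w x k\<close> edges between \<open>j\<close> and \<open>k\<close>. The restriction of \<open>r\<close>, divided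
  by its greatest common divisor \<open>g\<close>, is an arithmetical structure on the resulting connected graph.
  Maximality of \<open>r x\<close> gives \<open>d \<le> deg x\<close>, so a graph with \<open>E\<close> edges becomes one with at most
  \<open>E\<^sup>2 / 2\<close> edges. Since \<open>g\<close> is coprime to \<open>r x\<close>, it divides \<open>d\<close>; hence \<open>r x\<close> is at most
  \<open>deg x\<close> times the largest entry of the new structure, and induction on the number of vertices
  applies.
\<close>

lemma Gcd_div_Gcd:
  fixes A :: "'a :: semiring_Gcd set"
  assumes "Gcd A \<noteq> 0"
  shows "Gcd ((\<lambda>a. a div Gcd A) ` A) = 1"
proof -
  let ?B = "(\<lambda>a. a div Gcd A) ` A"
  have "(*) (Gcd A) ` ?B = (\<lambda>a. a) ` A"
    unfolding image_image by (intro image_cong) (simp_all add: Gcd_dvd)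
  then have "normalize (Gcd A * Gcd ?B) = Gcd A"
    using Gcd_mult[of "Gcd A" ?B] by simp
  then have "Gcd A * Gcd ?B dvd Gcd A * 1"
    by (metis dvd_refl mult_1_right normalize_dvd_iff)
  with assms have "is_unit (Gcd ?B)"
    by (metis dvd_times_left_cancel_iff)
  then show ?thesis by (metis is_unit_normalize normalize_Gcd)
qed


subsection \<open>Edge weights\<close>

definition degree :: "'v set \<Rightarrow> ('v \<Rightarrow> 'v \<Rightarrow> nat) \<Rightarrow> 'v \<Rightarrow> nat" where
  "degree A w a = (\<Sum>b\<in>A. w a b)"

definition edge_count :: "'v set \<Rightarrow> ('v \<Rightarrow> 'v \<Rightarrow> nat) \<Rightarrow> nat" where
  "edge_count A w = (\<Sum>a\<in>A. degree A w a) div 2"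

definition eliminate :: "('v \<Rightarrow> 'v \<Rightarrow> nat) \<Rightarrow> 'v \<Rightarrow> nat \<Rightarrow> 'v \<Rightarrow> 'v \<Rightarrow> nat" where
  "eliminate w x d a b = (if a = b then 0 else d * w a b + w a x * w x b)"

locale loopless_weights =
  fixes w :: "'v \<Rightarrow> 'v \<Rightarrow> nat"
  assumes weight_commute: "w a b = w b a"
    and weight_self [simp]: "w a a = 0"
begin

lemma sum_mult_weight_remove:
  assumes "finite A"
  shows "(\<Sum>b\<in>A - {x}. f b * w x b) = (\<Sum>b\<in>A. f b * w x b)"
  using assms by (intro sum.mono_neutral_left) auto

lemma degree_remove: "finite A \<Longrightarrow> degree (A - {x}) w x = degree A w x"
  using sum_mult_weight_remove[of A "\<lambda>_. 1" x] by (simp add: degree_def)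

lemma sum_degree_remove:
  assumes "finite A" "x \<in> A"
  shows "(\<Sum>a\<in>A. degree A w a) = (\<Sum>a\<in>A - {x}. degree (A - {x}) w a) + 2 * degree A w x"
proof -
  have "(\<Sum>a\<in>A. degree A w a) = degree A w x + (\<Sum>a\<in>A - {x}. w a x + degree (A - {x}) w a)"
    unfolding degree_def by (simp add: sum.remove[OF assms])
  also have "\<dots> = degree A w x + degree (A - {x}) w x + (\<Sum>a\<in>A - {x}. degree (A - {x}) w a)"
    by (simp add: sum.distrib degree_def weight_commute[of x])
  finally show ?thesis
    using assms(1) by (simp add: degree_remove)
qed

lemma edge_count_remove:
  assumes "finite A" "x \<in> A"
  shows "edge_count A w = edge_count (A - {x}) w + degree A w x"
  by (simp add: edge_count_def sum_degree_remove[OF assms])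

lemma handshake:
  assumes "finite A"
  shows "(\<Sum>a\<in>A. degree A w a) = 2 * edge_count A w"
proof -
  have "even (\<Sum>a\<in>A. degree A w a)"
    using assms
  proof (induction rule: finite_remove_induct)
    case (remove A)
    then obtain x where "x \<in> A" by blast
    with remove show ?case by (simp add: sum_degree_remove)
  qed simp
  then show ?thesis by (simp add: edge_count_def)
qed

lemma loopless_weights_eliminate: "loopless_weights (eliminate w x d)"
proof
  show "eliminate w x d a b = eliminate w x d b a" for a b
    by (simp add: eliminate_def weight_commute[of a b] weight_commute[of a x] weight_commute[of b x])
qed (simp add: eliminate_def)

lemma edge_count_eliminate:
  assumes "finite A" "x \<in> A" "d \<le> degree A w x"
  shows "2 * edge_count (A - {x}) (eliminate w x d) \<le> (edge_count A w)\<^sup>2"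
proof -
  let ?A = "A - {x}"
  define D where "D = degree A w x"
  define U where "U = edge_count ?A w"
  have D: "(\<Sum>b\<in>?A. w x b) = D"
    using degree_remove[OF assms(1)] by (simp add: D_def degree_def)
  have "2 * edge_count ?A (eliminate w x d) \<le> (\<Sum>a\<in>?A. \<Sum>b\<in>?A. eliminate w x d a b)"
    by (simp add: edge_count_def degree_def)
  also have "\<dots> \<le> (\<Sum>a\<in>?A. \<Sum>b\<in>?A. d * w a b + w a x * w x b)"
    by (intro sum_mono) (auto simp: eliminate_def)
  also have "\<dots> = d * (\<Sum>a\<in>?A. degree ?A w a) + (\<Sum>a\<in>?A. w x a) * (\<Sum>b\<in>?A. w x b)"
    by (simp add: sum.distrib degree_def weight_commute[of _ x]
        flip: sum_distrib_left sum_distrib_right)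
  also have "\<dots> = 2 * d * U + D\<^sup>2"
    using assms(1) by (simp add: handshake U_def D power2_eq_square)
  also have "\<dots> \<le> 2 * D * U + D\<^sup>2"
    using assms(3) by (simp add: D_def)
  also have "\<dots> \<le> (U + D)\<^sup>2"
    by (simp add: power2_sum)
  also have "U + D = edge_count A w"
    by (simp add: edge_count_remove[OF assms(1,2)] U_def D_def)
  finally show ?thesis .
qed

lemma sum_mult_eliminate:
  fixes f :: "'v \<Rightarrow> nat"
  assumes "finite A" "x \<in> A" "a \<in> A - {x}" and fx: "f x * d = (\<Sum>b\<in>A. f b * w x b)"
  shows "(\<Sum>b\<in>A - {x}. f b * eliminate w x d a b) + f a * (w x a)\<^sup>2
    = d * (\<Sum>b\<in>A. f b * w a b)"
proof -
  let ?A = "A - {x}"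
  have fin: "finite ?A" using assms(1) by simp
  have "(\<Sum>b\<in>?A. f b * eliminate w x d a b) + f a * (w x a)\<^sup>2
      = (\<Sum>b\<in>?A. f b * (d * w a b + w a x * w x b))"
  proof -
    have "(\<Sum>b\<in>?A - {a}. f b * eliminate w x d a b)
        = (\<Sum>b\<in>?A - {a}. f b * (d * w a b + w a x * w x b))"
      by (intro sum.cong) (auto simp: eliminate_def)
    then show ?thesis
      by (simp add: sum.remove[OF fin assms(3)] eliminate_def weight_commute[of a x] power2_eq_square)
  qed
  also have "\<dots> = d * (\<Sum>b\<in>?A. f b * w a b) + w a x * (\<Sum>b\<in>?A. f b * w x b)"
    by (simp add: sum.distrib sum_distrib_left algebra_simps)
  also have "\<dots> = d * (\<Sum>b\<in>?A. f b * w a b) + w a x * (f x * d)"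
    using assms(1) by (simp add: sum_mult_weight_remove fx)
  also have "\<dots> = d * (\<Sum>b\<in>A. f b * w a b)"
    by (simp add: sum.remove[OF assms(1,2)] algebra_simps)
  finally show ?thesis .
qed

end


subsection \<open>Connected weights\<close>

text \<open>Connectedness is stated through cuts because this form passes easily to the graph with a
  vertex eliminated.\<close>

locale connected_weights = loopless_weights w
  for V :: "'v set" and w :: "'v \<Rightarrow> 'v \<Rightarrow> nat" +
  assumes finite_vertices: "finite V"
    and cut_edge: "S \<subseteq> V \<Longrightarrow> S \<noteq> {} \<Longrightarrow> S \<noteq> V \<Longrightarrow> \<exists>a\<in>S. \<exists>b\<in>V - S. w a b > 0"
begin

lemma obtain_neighbour:
  assumes "x \<in> V" "V \<noteq> {x}"
  obtains y where "y \<in> V - {x}" "w x y > 0"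
  using cut_edge[of "{x}"] assms by auto

lemma connected_weights_eliminate:
  assumes "x \<in> V" "d > 0"
  shows "connected_weights (V - {x}) (eliminate w x d)"
proof (intro connected_weights.intro connected_weights_axioms.intro loopless_weights_eliminate)
  fix S assume S: "S \<subseteq> V - {x}" "S \<noteq> {}" "S \<noteq> V - {x}"
  let ?T = "V - {x} - S"
  show "\<exists>a\<in>S. \<exists>b\<in>?T. eliminate w x d a b > 0"
  proof (cases "\<exists>a\<in>S. \<exists>b\<in>?T. w a b > 0")
    case True
    then obtain a b where "a \<in> S" "b \<in> ?T" "w a b > 0" by blast
    moreover from this have "eliminate w x d a b > 0"
      using \<open>d > 0\<close> by (auto simp: eliminate_def)
    ultimately show ?thesis by blast
  next
    case no_direct_edge: False
    have "\<exists>a\<in>S. \<exists>b\<in>V - S. w a b > 0"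
      using S \<open>x \<in> V\<close> by (intro cut_edge) auto
    with no_direct_edge obtain a where a: "a \<in> S" "w a x > 0" by blast
    have "\<exists>b\<in>?T. \<exists>a\<in>V - ?T. w b a > 0"
      using S \<open>x \<in> V\<close> by (intro cut_edge) auto
    with no_direct_edge obtain b where b: "b \<in> ?T" "w x b > 0"
      by (metis Diff_iff insertE emptyE weight_commute)
    have "eliminate w x d a b > 0"
      using a b by (auto simp: eliminate_def)
    with a b show ?thesis by blast
  qed
qed (simp add: finite_vertices)

end


subsection \<open>Arithmetical structures on connected weights\<close>

locale arithmetical_weights = connected_weights V w
  for V :: "'v set" and w :: "'v \<Rightarrow> 'v \<Rightarrow> nat" +
  fixes r d :: "'v \<Rightarrow> nat"
  assumes r_pos: "a \<in> V \<Longrightarrow> r a > 0"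
    and Gcd_r: "Gcd (r ` V) = 1"
    and balance: "a \<in> V \<Longrightarrow> r a * d a = (\<Sum>b\<in>V. r b * w a b)"

lemma (in connected_weights) arithmetical_weights_div_Gcd:
  fixes r :: "'v \<Rightarrow> nat"
  assumes "V \<noteq> {}" and r_pos: "\<And>a. a \<in> V \<Longrightarrow> r a > 0"
    and balance: "\<And>a. a \<in> V \<Longrightarrow> r a * d a = (\<Sum>b\<in>V. r b * w a b)"
  shows "arithmetical_weights V w (\<lambda>a. r a div Gcd (r ` V)) d"
proof
  define g where "g = Gcd (r ` V)"
  have r_eq: "r a = g * (r a div g)" if "a \<in> V" for a
    using that by (simp add: g_def)
  have "g > 0"
    using assms(1) r_pos by (force simp: g_def)
  show "r a div Gcd (r ` V) > 0" if "a \<in> V" for a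
    using r_eq[OF that] r_pos[OF that] unfolding g_def by (auto intro: gr0I)
  show "Gcd ((\<lambda>a. r a div Gcd (r ` V)) ` V) = 1"
    using Gcd_div_Gcd[of "r ` V"] \<open>g > 0\<close> unfolding g_def image_image by blast
  show "r a div Gcd (r ` V) * d a = (\<Sum>b\<in>V. r b div Gcd (r ` V) * w a b)" if "a \<in> V" for a
  proof -
    have "g * (r a div g * d a) = (\<Sum>b\<in>V. r b * w a b)"
      using balance[OF that] r_eq[OF that] by (metis mult.assoc)
    also have "\<dots> = g * (\<Sum>b\<in>V. r b div g * w a b)"
      using r_eq by (simp add: sum_distrib_left flip: mult.assoc)
    finally show ?thesis using \<open>g > 0\<close> unfolding g_def by (metis mult_left_cancel less_not_refl)
  qed
qed

context arithmetical_weights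
begin

abbreviation reduced_r :: "'v \<Rightarrow> 'v \<Rightarrow> nat" where
  "reduced_r x a \<equiv> r a div Gcd (r ` (V - {x}))"

lemma balance_remove: "x \<in> V \<Longrightarrow> r x * d x = (\<Sum>b\<in>V - {x}. r b * w x b)"
  by (simp add: balance sum_mult_weight_remove finite_vertices)

lemma d_pos:
  assumes "x \<in> V" "V \<noteq> {x}"
  shows "d x > 0"
proof -
  obtain y where y: "y \<in> V - {x}" "w x y > 0"
    using assms by (rule obtain_neighbour)
  then have "0 < r y * w x y" using r_pos by simp
  also have "\<dots> \<le> r x * d x"
    unfolding balance_remove[OF assms(1)] using y finite_vertices
    by (intro member_le_sum) auto
  finally show ?thesis by simp
qed

lemma d_le_degree:
  assumes "x \<in> V" and max: "\<And>y. y \<in> V \<Longrightarrow> r y \<le> r x"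
  shows "d x \<le> degree V w x"
proof -
  have "r x * d x \<le> (\<Sum>b\<in>V. r x * w x b)"
    unfolding balance[OF assms(1)] by (intro sum_mono mult_right_mono max) auto
  then show ?thesis
    using r_pos[OF assms(1)] by (simp add: degree_def flip: sum_distrib_left)
qed

lemma Gcd_remove_dvd_d:
  assumes "x \<in> V"
  shows "Gcd (r ` (V - {x})) dvd d x"
proof -
  have "V = insert x (V - {x})" using assms by blast
  then have "gcd (r x) (Gcd (r ` (V - {x}))) = 1"
    using Gcd_r by (metis Gcd_insert image_insert)
  then have "coprime (Gcd (r ` (V - {x}))) (r x)"
    by (simp add: coprime_iff_gcd_eq_1 gcd.commute)
  moreover have "Gcd (r ` (V - {x})) dvd r x * d x"
    unfolding balance_remove[OF assms] by (intro dvd_sum dvd_mult2 Gcd_dvd) auto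
  ultimately show ?thesis by (simp add: coprime_dvd_mult_right_iff)
qed

text \<open>The subtraction is never truncated: \<open>balance\<close> at \<open>x\<close> and at \<open>a\<close> yields
  \<open>w x a * r a \<le> r x * d x\<close> and \<open>w x a * r x \<le> r a * d a\<close>.\<close>

lemma arithmetical_weights_eliminate:
  assumes "x \<in> V" "V \<noteq> {x}"
  shows "arithmetical_weights (V - {x}) (eliminate w x (d x)) (reduced_r x)
    (\<lambda>a. d x * d a - (w x a)\<^sup>2)"
proof (rule connected_weights.arithmetical_weights_div_Gcd)
  show "connected_weights (V - {x}) (eliminate w x (d x))"
    using assms by (intro connected_weights_eliminate d_pos)
  show "r a * (d x * d a - (w x a)\<^sup>2) = (\<Sum>b\<in>V - {x}. r b * eliminate w x (d x) a b)"
    if "a \<in> V - {x}" for a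
  proof -
    have "(\<Sum>b\<in>V - {x}. r b * eliminate w x (d x) a b) + r a * (w x a)\<^sup>2 = d x * (r a * d a)"
      using that assms(1) by (simp add: sum_mult_eliminate finite_vertices balance)
    then show ?thesis by (simp add: diff_mult_distrib2 mult.left_commute)
  qed
qed (use assms r_pos in auto)

lemma r_le_degree_mult_reduced_r:
  assumes "x \<in> V" "V \<noteq> {x}"
  obtains b where "b \<in> V - {x}" "r x \<le> degree V w x * reduced_r x b"
proof -
  define g where "g = Gcd (r ` (V - {x}))"
  define M where "M = Max (reduced_r x ` (V - {x}))"
  have "M \<in> reduced_r x ` (V - {x})"
    unfolding M_def using assms finite_vertices by (intro Max_in) auto
  then obtain b where b: "b \<in> V - {x}" "M = reduced_r x b" by blast
  have r_le: "r a \<le> g * M" if "a \<in> V - {x}" for a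
  proof -
    have "r a = g * reduced_r x a"
      using that by (simp add: g_def)
    also have "\<dots> \<le> g * M"
      using that finite_vertices by (simp add: M_def)
    finally show ?thesis .
  qed
  have "g \<le> d x"
    using Gcd_remove_dvd_d[OF assms(1)] d_pos[OF assms] by (simp add: g_def dvd_imp_le)
  have "r x * d x \<le> (\<Sum>a\<in>V - {x}. g * M * w x a)"
    unfolding balance_remove[OF assms(1)] by (intro sum_mono mult_right_mono r_le) auto
  also have "\<dots> = g * (degree V w x * M)"
    using sum_mult_weight_remove[OF finite_vertices, of "\<lambda>_. g * M" x]
    by (simp add: degree_def sum_distrib_left mult_ac)
  also have "\<dots> \<le> d x * (degree V w x * M)"
    using \<open>g \<le> d x\<close> by (rule mult_right_mono) simp
  finally have "r x \<le> degree V w x * M"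
    using d_pos[OF assms] by (simp add: mult.commute)
  with b show thesis using that by blast
qed

lemma obtain_elimination:
  assumes "a \<in> V" "\<And>y. V \<noteq> {y}"
  obtains x b where "x \<in> V" "b \<in> V - {x}" "r a \<le> edge_count V w * reduced_r x b"
    "2 * edge_count (V - {x}) (eliminate w x (d x)) \<le> (edge_count V w)\<^sup>2"
proof -
  have "Max (r ` V) \<in> r ` V"
    using finite_vertices assms(1) by (intro Max_in) auto
  then obtain x where x: "x \<in> V" and "r x = Max (r ` V)" by auto
  then have r_le: "r y \<le> r x" if "y \<in> V" for y
    using finite_vertices that by simp
  obtain b where b: "b \<in> V - {x}" and r_x_le: "r x \<le> degree V w x * reduced_r x b"
    using x assms(2) by (rule r_le_degree_mult_reduced_r)
  have "r a \<le> r x"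
    using assms(1) by (rule r_le)
  also note r_x_le
  also have "degree V w x * reduced_r x b \<le> edge_count V w * reduced_r x b"
    using edge_count_remove[OF finite_vertices x] by (intro mult_right_mono) auto
  finally have "r a \<le> edge_count V w * reduced_r x b" .
  moreover have "2 * edge_count (V - {x}) (eliminate w x (d x)) \<le> (edge_count V w)\<^sup>2"
    using x r_le by (intro edge_count_eliminate finite_vertices d_le_degree)
  ultimately show thesis using x b that by blast
qed

lemma r_le_edge_count:
  assumes "card V = 2" "a \<in> V"
  shows "r a \<le> edge_count V w"
proof -
  obtain b where V: "V = {a, b}" "a \<noteq> b"
    using assms by (auto simp: card_2_iff)
  have "coprime (r a) (r b)"
    using Gcd_r V by (simp add: coprime_iff_gcd_eq_1)
  moreover have "r a * d a = r b * w a b"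
    using balance[OF assms(2)] V by simp
  then have "r a dvd r b * w a b" by (metis dvd_triv_left)
  ultimately have "r a dvd w a b"
    by (simp add: coprime_dvd_mult_right_iff)
  moreover have "w a b > 0"
    using obtain_neighbour[OF assms(2)] V by auto
  ultimately have "r a \<le> w a b" by (rule dvd_imp_le)
  also have "w a b = edge_count V w"
    using edge_count_remove[OF finite_vertices assms(2)] V
    by (simp add: degree_def edge_count_def)
  finally show ?thesis .
qed

end


subsection \<open>Induction on the number of vertices\<close>

lemma exponent_Suc: "3 * 2 ^ Suc m - 2 = 2 * (3 * 2 ^ m - 2) + (2 :: nat)"
  using one_le_power[of "2 :: nat" m] unfolding power_Suc by arith

lemma add_2_le_two_power_exponent: "m + 2 \<le> (2 :: nat) ^ (3 * 2 ^ m - 2)"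
proof (induction m)
  case (Suc m)
  have "Suc m + 2 \<le> (2 :: nat) ^ Suc (3 * 2 ^ m - 2)"
    using Suc.IH by simp
  also have "\<dots> \<le> 2 ^ (3 * 2 ^ Suc m - 2)"
    unfolding exponent_Suc by (intro power_increasing) simp_all
  finally show ?case .
qed simp

lemma fact_mult_le_power_step:
  fixes t s E E' :: nat
  assumes "fact (m + 1) * s \<le> E' ^ (3 * 2 ^ m - 2)" "t \<le> E * s" "2 * E' \<le> E\<^sup>2"
  shows "fact (Suc m + 1) * t \<le> E ^ (3 * 2 ^ Suc m - 2)"
proof (cases "E = 0")
  case True
  with assms(2) show ?thesis by simp
next
  case False
  define e :: nat where "e = 3 * 2 ^ m - 2"
  have "fact (Suc m + 1) * t = (m + 2) * (fact (m + 1) * t)"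
    by (simp add: algebra_simps)
  also have "\<dots> \<le> 2 ^ e * (fact (m + 1) * (E * s))"
    unfolding e_def by (intro mult_mono add_2_le_two_power_exponent assms(2)) auto
  also have "\<dots> = 2 ^ e * E * (fact (m + 1) * s)"
    by (simp only: mult_ac)
  also have "\<dots> \<le> 2 ^ e * E * E' ^ e"
    using assms(1) unfolding e_def by (rule mult_left_mono) simp
  also have "\<dots> = E * (2 * E') ^ e"
    by (simp add: power_mult_distrib)
  also have "\<dots> \<le> E * (E\<^sup>2) ^ e"
    using assms(3) by (intro mult_left_mono power_mono) auto
  also have "\<dots> = E ^ (2 * e + 1)"
    by (simp add: power_mult)
  also have "\<dots> \<le> E ^ (3 * 2 ^ Suc m - 2)"
    using False unfolding exponent_Suc e_def by (intro power_increasing) auto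
  finally show ?thesis .
qed

theorem arithmetical_weights_bound:
  assumes "arithmetical_weights V w r d" "card V = m + 2" "a \<in> V"
  shows "fact (m + 1) * r a \<le> edge_count V w ^ (3 * 2 ^ m - 2)"
  using assms
proof (induction m arbitrary: V w r d a)
  case 0
  then show ?case
    using arithmetical_weights.r_le_edge_count by fastforce
next
  case (Suc m)
  interpret arithmetical_weights V w r d by fact
  have "V \<noteq> {y}" for y using Suc.prems(2) by auto
  then obtain x b where x: "x \<in> V" and b: "b \<in> V - {x}"
    and "r a \<le> edge_count V w * reduced_r x b"
    and "2 * edge_count (V - {x}) (eliminate w x (d x)) \<le> (edge_count V w)\<^sup>2"
    using \<open>a \<in> V\<close> obtain_elimination by metis
  moreover have "card (V - {x}) = m + 2"
    using x Suc.prems(2) by (simp add: finite_vertices)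
  with arithmetical_weights_eliminate[OF x \<open>V \<noteq> {x}\<close>]
  have "fact (m + 1) * reduced_r x b
      \<le> edge_count (V - {x}) (eliminate w x (d x)) ^ (3 * 2 ^ m - 2)"
    using b by (rule Suc.IH)
  ultimately show ?case by (intro fact_mult_le_power_step)
qed


subsection \<open>Multigraphs\<close>

lemma loopless_weights_edge_mult:
  assumes "loopless_multigraph G"
  shows "loopless_weights (edge_mult G)"
proof
  show "edge_mult G x y = edge_mult G y x" for x y
    by (simp add: edge_mult_def insert_commute)
  show "edge_mult G x x = 0" for x
    using assms by (auto simp: edge_mult_def loopless_multigraph_def)
qed

lemma edge_count_edge_mult:
  assumes "loopless_multigraph G"
  shows "edge_count (verts G) (edge_mult G) = card (edges G)"
proof -
  let ?V = "verts G" and ?E = "edges G"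
  have fin: "finite ?V" "finite ?E"
    and ends: "\<And>e. e \<in> ?E \<Longrightarrow> ends G e \<subseteq> ?V \<and> card (ends G e) = 2"
    using assms by (auto simp: loopless_multigraph_def)
  have "(\<Sum>x\<in>?V. degree ?V (edge_mult G) x)
      = (\<Sum>p\<in>?V \<times> ?V. card {e \<in> ?E. ends G e = {fst p, snd p}})"
    by (simp add: degree_def sum.cartesian_product edge_mult_def case_prod_beta)
  also have "\<dots> = 2 * card ?E"
  proof (rule sum_multicount)
    show "\<forall>e\<in>?E. card {p \<in> ?V \<times> ?V. ends G e = {fst p, snd p}} = 2"
    proof
      fix e assume "e \<in> ?E"
      then obtain a b where ab: "ends G e = {a, b}" "a \<noteq> b" "a \<in> ?V" "b \<in> ?V"
        using ends[of e] by (auto simp: card_2_iff)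
      then have "{p \<in> ?V \<times> ?V. ends G e = {fst p, snd p}} = {(a, b), (b, a)}"
        unfolding ab(1) doubleton_eq_iff by auto
      then show "card {p \<in> ?V \<times> ?V. ends G e = {fst p, snd p}} = 2"
        using ab by simp
    qed
  qed (use fin in auto)
  finally show ?thesis by (simp add: edge_count_def)
qed

lemma connected_weights_edge_mult:
  assumes "loopless_multigraph G" "connected_multigraph G"
  shows "connected_weights (verts G) (edge_mult G)"
proof (intro connected_weights.intro connected_weights_axioms.intro
    loopless_weights_edge_mult assms(1))
  show "finite (verts G)"
    using assms(1) by (simp add: loopless_multigraph_def)
  fix S assume S: "S \<subseteq> verts G" "S \<noteq> {}" "S \<noteq> verts G"
  then obtain x y where x: "x \<in> S" and y: "y \<in> verts G" "y \<notin> S" by blast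
  have "(x, y) \<in> (adjacency G)\<^sup>*"
    using assms(2) S x y by (auto simp: connected_multigraph_def)
  then have "y \<in> S \<or> (\<exists>a\<in>S. \<exists>b. b \<notin> S \<and> (a, b) \<in> adjacency G)"
    by (induction rule: rtrancl_induct) (use x in auto)
  with y obtain a b e where e: "a \<in> S" "b \<notin> S" "e \<in> edges G" "ends G e = {a, b}"
    by (auto simp: adjacency_def)
  moreover have "b \<in> verts G" "finite (edges G)"
    using assms(1) e by (auto simp: loopless_multigraph_def)
  moreover from this e have "edge_mult G a b > 0"
    by (auto simp: edge_mult_def card_gt_0_iff)
  ultimately show "\<exists>a\<in>S. \<exists>b\<in>verts G - S. edge_mult G a b > 0" by blast
qed

lemma arithmetical_weights_edge_mult:
  assumes "loopless_multigraph G" "connected_multigraph G" "arithmetical_structure G r d"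
  shows "arithmetical_weights (verts G) (edge_mult G) r d"
proof -
  interpret connected_weights "verts G" "edge_mult G"
    using assms(1,2) by (rule connected_weights_edge_mult)
  show ?thesis
    using assms(3)
    by unfold_locales
      (simp_all add: arithmetical_structure_def sum_mult_weight_remove finite_vertices)
qed

theorem theorem3p4:
  fixes G :: "('v, 'e) multigraph" and n :: nat
    and r d :: "'v \<Rightarrow> nat" and v :: "nat \<Rightarrow> 'v"
  assumes "loopless_multigraph G"
    and "connected_multigraph G"
    and "n \<ge> 2"
    and "bij_betw v {1..n} (verts G)"
    and "arithmetical_structure G r d"
    and "\<And>i j. 1 \<le> i \<Longrightarrow> i \<le> j \<Longrightarrow> j \<le> n \<Longrightarrow> r (v j) \<le> r (v i)"
  shows "real (r (v 1)) \<le> 1 / fact (n - 1) * real (card (edges G)) ^ (3 * 2 ^ (n - 2) - 2)"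
proof -
  have "card (verts G) = n - 2 + 2"
    using bij_betw_same_card[OF assms(4)] \<open>n \<ge> 2\<close> by simp
  moreover have "v 1 \<in> verts G"
    using bij_betwE[OF assms(4)] \<open>n \<ge> 2\<close> by simp
  ultimately have "fact (n - 2 + 1) * r (v 1)
      \<le> edge_count (verts G) (edge_mult G) ^ (3 * 2 ^ (n - 2) - 2)"
    by (rule arithmetical_weights_bound[OF arithmetical_weights_edge_mult[OF assms(1,2,5)]])
  moreover have "n - 2 + 1 = n - 1" using \<open>n \<ge> 2\<close> by simp
  ultimately have "fact (n - 1) * r (v 1) \<le> card (edges G) ^ (3 * 2 ^ (n - 2) - 2)"
    by (simp only: edge_count_edge_mult[OF assms(1)])
  from of_nat_mono[OF this, where 'a = real] show ?thesis
    by (simp add: field_simps)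
qed

end
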